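(* Let $n>2$ be an integer, let $r$ be a Golay number, and let $k_1,k_2,\dots,k_{2^{n-3}-1}$ be complex Golay numbers (for $n=3$ this list is empty). Put $m=2\sum_{j=1}^{2^{n-3}-1}k_j+r+1$ and $q=2^{n-1}+n-1$. Then there exists a complex orthogonal design $$COD\Big(2^q m;\ 2^q,\ 2^q r,\ 2^{q+1}k_1,\ \dots,\ 2^{q+1}k_{2^{n-3}-1}\Big).$$
   Context: For a sequence $A=(a_1,\dots,a_n)$ of complex numbers, its non-periodic autocorrelation function is $N_A(j)=\sum_{i=1}^{n-j}a_{i+j}\overline{a_i}$ for $0\le j\le n-1$ and $N_A(j)=0$ for $j\ge n$. A Golay pair of length $n$ is a pair $(A;B)$ of sequences of length $n$ with entries in $\{\pm1\}$ such that $N_A(j)+N_B(j)=0$ for all $j>0$; a Golay number is a positive integer $n$ for which a Golay pair of length $n$ exists. A complex Golay pair of length $n$ is a pair of sequences of length $n$ with entries in $\{\pm1,\pm i\}$ with the same property, and a complex Golay number is a positive integer for which a complex Golay pair of that length exists. A complex orthogonal design $COD(N;\,c_1,\dots,c_k)$ is an $N\times N$ matrix $X$ with entries from $\{0,\pm x_1,\pm ix_1,\dots,\pm x_k,\pm ix_k\}$ ($x_j$ commuting real variables) satisfying $XX^*=\big(\sum_{j=1}^k c_jx_j^2\big)I_N$ with positive integers $c_j$, where $*$ denotes conjugate transpose. *)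

theory Defs
  imports Complex_Main "HOL-Library.Poly_Mapping" "Jordan_Normal_Form.Matrix"
begin

text \<open>A sequence $(a_1,\dots,a_n)$ is a list, so $a_i$ is \<open>A ! (i - 1)\<close>. For \<open>j \<ge> length A\<close> the
  truncated subtraction makes the sum empty, as required.\<close>

definition autocorr :: "complex list \<Rightarrow> nat \<Rightarrow> complex" where
  "autocorr A j = (\<Sum>i<length A - j. A ! (i + j) * cnj (A ! i))"

definition complementary :: "complex list \<Rightarrow> complex list \<Rightarrow> bool" where
  "complementary A B \<longleftrightarrow> (\<forall>j>0. autocorr A j + autocorr B j = 0)"

definition golay_pair :: "nat \<Rightarrow> complex list \<Rightarrow> complex list \<Rightarrow> bool" where
  "golay_pair n A B \<longleftrightarrow> length A = n \<and> length B = n \<and>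
     set A \<subseteq> {1, -1} \<and> set B \<subseteq> {1, -1} \<and> complementary A B"

definition golay_number :: "nat \<Rightarrow> bool" where
  "golay_number n \<longleftrightarrow> n > 0 \<and> (\<exists>A B. golay_pair n A B)"

definition complex_golay_pair :: "nat \<Rightarrow> complex list \<Rightarrow> complex list \<Rightarrow> bool" where
  "complex_golay_pair n A B \<longleftrightarrow> length A = n \<and> length B = n \<and>
     set A \<subseteq> {1, -1, \<i>, -\<i>} \<and> set B \<subseteq> {1, -1, \<i>, -\<i>} \<and> complementary A B"

definition complex_golay_number :: "nat \<Rightarrow> bool" where
  "complex_golay_number n \<longleftrightarrow> n > 0 \<and> (\<exists>A B. complex_golay_pair n A B)"

text \<open>Polynomials with complex coefficients in the commuting variables $x_0, x_1, \dots$: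
  a power product is a finitely supported map from variable indices to exponents.\<close>

type_synonym cpoly = "(nat \<Rightarrow>\<^sub>0 nat) \<Rightarrow>\<^sub>0 complex"

definition cterm :: "complex \<Rightarrow> nat \<Rightarrow> cpoly" where
  "cterm u j = Poly_Mapping.single (Poly_Mapping.single j 1) u"

abbreviation var :: "nat \<Rightarrow> cpoly" where
  "var j \<equiv> cterm 1 j"

text \<open>The variables are real, so conjugation fixes them and acts on the coefficients only.\<close>

definition conj_transpose :: "cpoly mat \<Rightarrow> cpoly mat" where
  "conj_transpose X = transpose_mat (map_mat (Poly_Mapping.map cnj) X)"

text \<open>The list \<open>cs\<close> holds $c_1,\dots,c_k$; the variable belonging to \<open>cs ! j\<close> is \<open>var j\<close>.\<close>

definition is_COD :: "nat \<Rightarrow> nat list \<Rightarrow> cpoly mat \<Rightarrow> bool" where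
  "is_COD N cs X \<longleftrightarrow> X \<in> carrier_mat N N \<and>
     (\<forall>c\<in>set cs. c > 0) \<and>
     elements_mat X \<subseteq> {0} \<union> {cterm u j | u j. u \<in> {1, -1, \<i>, -\<i>} \<and> j < length cs} \<and>
     X * conj_transpose X = (\<Sum>j<length cs. of_nat (cs ! j) * (var j)\<^sup>2) \<cdot>\<^sub>m 1\<^sub>m N"

end

theory Submission
  imports Defs "HOL-Library.Nat_Bijection"
begin

text \<open>
  Split the \<open>m\<close> positions into \<open>2\<^sup>e\<close> blocks, \<open>e = n - 2\<close>: one of length 1 for the first variable,
  one of length \<open>r\<close> for the second, and two of length \<open>k\<^sub>j\<close> for each further variable. Write a
  sequence as a Laurent polynomial in \<open>t\<close>, so that its autocorrelation is the product with the
  conjugate polynomial in \<open>t\<^sup>-\<^sup>1\<close>, and let \<open>(A\<^sub>v; B\<^sub>v)\<close> be a complex Golay pair filling block \<open>v\<close>,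
  scaled by its variable. Taking the rows \<open>h\<close> of a Sylvester matrix \<open>H\<close> as signs, the \<open>p = 2\<^bsup>n-1\<^esup>\<close>
  concatenations of the \<open>H\<^sub>h\<^sub>v A\<^sub>v\<close>, respectively the \<open>H\<^sub>h\<^sub>v B\<^sub>v\<close>, are complementary: distinct blocks
  cancel by orthogonality of the columns of \<open>H\<close>, whatever their positions.

  Passing to the quotient \<open>t\<^sup>m = 1\<close> turns the sequences into commuting circulant matrices \<open>X\<^sub>c\<close>,
  \<open>c < p\<close>, with \<open>\<Sum>\<^sub>c X\<^sub>c X\<^sub>c\<^sup>*\<close> scalar. On the \<open>2\<^sup>p\<close> subsets \<open>S\<close> of \<open>{..<p}\<close> let \<open>D\<^sub>c\<close> toggle \<open>c\<close>
  with coefficient \<open>X\<^sub>c\<close> or \<open>X\<^sub>c\<^sup>*\<close> according to whether \<open>c \<notin> S\<close> or \<open>c \<in> S\<close>, and with the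
  Jordan--Wigner sign given by the number of elements of \<open>S\<close> below \<open>c\<close>. The \<open>D\<^sub>c\<close> are Hermitian and
  anticommute, so in the \<open>p \<times> p\<close> block matrix with \<open>(a, b)\<close> block \<open>D\<close> indexed by \<open>a XOR b\<close> the cross
  terms of rows \<open>a \<noteq> a'\<close> cancel in pairs \<open>b\<close>, \<open>b XOR a XOR a'\<close>. Multiplying each block on the right
  by the Sylvester matrix of order \<open>2\<^sup>p\<close> fills all zeros, since each \<open>D\<^sub>c\<close> is monomial in \<open>S\<close>.
\<close>

subsection \<open>Walsh characters and Sylvester matrices\<close>

definition walsh :: "'b set \<Rightarrow> 'b set \<Rightarrow> 'a :: comm_ring_1" where
  "walsh S U = (-1) ^ card (S \<inter> U)"

lemma walsh_eq_prod:
  fixes S U :: "'b set"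
  assumes "finite U"
  shows "walsh S U = (\<Prod>x\<in>U. if x \<in> S then -1 else (1 :: 'a :: comm_ring_1))"
proof -
  have "(\<Prod>x\<in>U. if x \<in> S then -1 else (1 :: 'a)) = (\<Prod>x\<in>U \<inter> S. -1)"
    by (rule prod.inter_restrict[OF assms, symmetric])
  then show ?thesis
    by (simp add: walsh_def Int_commute)
qed

lemma walsh_commute: "walsh S U = walsh U S"
  by (simp add: walsh_def Int_commute)

lemma walsh_self_mult: "walsh S U * walsh S U = 1"
  by (simp add: walsh_def flip: power_add)

lemma walsh_mult: "walsh S U * x = (if even (card (S \<inter> U)) then x else - x)"
  by (simp add: walsh_def)

lemma sum_walsh_mult_walsh:
  assumes "finite A" "S \<subseteq> A" "T \<subseteq> A"
  shows "(\<Sum>U\<in>Pow A. walsh S U * walsh T U) = (if S = T then 2 ^ card A else 0)"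
proof -
  define g :: "'a \<Rightarrow> 'b" where
    "g x = (if x \<in> S then -1 else 1) * (if x \<in> T then -1 else 1)" for x
  have "(\<Sum>U\<in>Pow A. walsh S U * walsh T U) = (\<Sum>U\<in>Pow A. \<Prod>x\<in>U. g x)"
    using assms(1)
    by (intro sum.cong) (auto simp: walsh_eq_prod finite_subset g_def prod.distrib)
  also have "\<dots> = (\<Prod>x\<in>A. g x + 1)"
    using assms(1) by (simp add: prod_add)
  also have "\<dots> = (if S = T then 2 ^ card A else 0)"
  proof (cases "S = T")
    case True
    then have "g x + 1 = 2" for x
      by (simp add: g_def)
    with True show ?thesis by simp
  next
    case False
    with assms obtain x where "x \<in> A" "x \<in> S \<longleftrightarrow> x \<notin> T" by blast
    then have "x \<in> A" "g x + 1 = 0"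
      by (auto simp: g_def)
    with False assms(1) show ?thesis by (auto intro: prod_zero)
  qed
  finally show ?thesis .
qed

lemma bij_betw_set_decode: "bij_betw set_decode {..<2 ^ e} (Pow {..<e})"
proof (rule bij_betw_byWitness[where f' = set_encode])
  show "set_decode ` {..<2 ^ e} \<subseteq> Pow {..<e}"
  proof clarsimp
    fix x i :: nat
    assume x_less: "x < 2 ^ e" and mem: "i \<in> set_decode x"
    show "i < e"
    proof (rule ccontr)
      assume "\<not> i < e"
      then have "(2 :: nat) ^ e \<le> 2 ^ i" by simp
      with x_less have "x div 2 ^ i = 0" by (intro div_less) (rule less_le_trans)
      with mem show False by (simp add: set_decode_def)
    qed
  qed
  show "set_encode ` Pow {..<e} \<subseteq> {..<2 ^ e}"
  proof clarsimp
    fix S assume "S \<subseteq> {..<e}"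
    then have "set_encode S \<le> (\<Sum>i = 0..<e. 2 ^ i)"
      unfolding set_encode_def by (intro sum_mono2) auto
    then show "set_encode S < 2 ^ e"
      by (simp add: sum_power2 le_diff_conv2 less_eq_Suc_le)
  qed
  show "\<forall>S\<in>Pow {..<e}. set_decode (set_encode S) = S"
    by (meson PowD finite_lessThan finite_subset set_encode_inverse)
qed simp

definition sylvester :: "nat \<Rightarrow> nat \<Rightarrow> 'a :: comm_ring_1" where
  "sylvester h v = walsh (set_decode h) (set_decode v)"

lemma sum_sylvester_mult_sylvester:
  assumes "v < 2 ^ e" "w < 2 ^ e"
  shows "(\<Sum>h<2 ^ e. sylvester h v * sylvester h w) = (if v = w then 2 ^ e else 0)"
proof -
  have "(\<Sum>h<2 ^ e. sylvester h v * sylvester h w) =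
      (\<Sum>U\<in>Pow {..<e}. walsh (set_decode v) U * walsh (set_decode w) U)"
    unfolding sylvester_def walsh_commute[of "set_decode _" "set_decode v"]
      walsh_commute[of "set_decode _" "set_decode w"]
    by (rule sum.reindex_bij_betw[OF bij_betw_set_decode])
  also have "\<dots> = (if set_decode v = set_decode w then 2 ^ e else 0)"
    using assms bij_betwE[OF bij_betw_set_decode] by (subst sum_walsh_mult_walsh) auto
  also have "set_decode v = set_decode w \<longleftrightarrow> v = w"
    by (metis set_decode_inverse)
  finally show ?thesis .
qed

lemma sum_sylvester_combinations:
  "(\<Sum>h<2 ^ e. (\<Sum>v<2 ^ e. sylvester h v * x v) * (\<Sum>v<2 ^ e. sylvester h v * y v)) =
    2 ^ e * (\<Sum>v<2 ^ e. x v * y v)"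
proof -
  have "(\<Sum>h<2 ^ e. (\<Sum>v<2 ^ e. sylvester h v * x v) * (\<Sum>v<2 ^ e. sylvester h v * y v)) =
      (\<Sum>h<2 ^ e. \<Sum>v<2 ^ e. \<Sum>w<2 ^ e. sylvester h v * sylvester h w * (x v * y w))"
    by (simp add: sum_product algebra_simps)
  also have "\<dots> = (\<Sum>v<2 ^ e. \<Sum>w<2 ^ e. \<Sum>h<2 ^ e. sylvester h v * sylvester h w * (x v * y w))"
    by (subst sum.swap) (intro sum.cong refl sum.swap)
  also have "\<dots> = (\<Sum>v<2 ^ e. \<Sum>w<2 ^ e. if v = w then 2 ^ e * (x v * y w) else 0)"
    by (intro sum.cong refl)
      (simp add: sum_sylvester_mult_sylvester flip: sum_distrib_right)
  finally show ?thesis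
    by (simp add: sum_distrib_left)
qed

subsection \<open>Autocorrelation and Laurent polynomials\<close>

lemma sum_square_diagonals:
  fixes g :: "nat \<Rightarrow> nat \<Rightarrow> 'a :: comm_monoid_add"
  shows "(\<Sum>i<l. \<Sum>j<l. g i j) =
    (\<Sum>i<l. g i i) + (\<Sum>d\<in>{1..<l}. \<Sum>j<l - d. g (j + d) j + g j (j + d))"
proof (induction l)
  case (Suc l)
  have "(\<Sum>d\<in>{1..<Suc l}. \<Sum>j<Suc l - d. g (j + d) j + g j (j + d)) =
      (\<Sum>d\<in>{1..<Suc l}. (\<Sum>j<l - d. g (j + d) j + g j (j + d)) + (g l (l - d) + g (l - d) l))"
    by (intro sum.cong) (auto simp: Suc_diff_le)
  also have "\<dots> = (\<Sum>d\<in>{1..<Suc l}. \<Sum>j<l - d. g (j + d) j + g j (j + d)) +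
      (\<Sum>d\<in>{1..<Suc l}. g l (l - d) + g (l - d) l)"
    by (rule sum.distrib)
  also have "(\<Sum>d\<in>{1..<Suc l}. \<Sum>j<l - d. g (j + d) j + g j (j + d)) =
      (\<Sum>d\<in>{1..<l}. \<Sum>j<l - d. g (j + d) j + g j (j + d))"
    by (cases l) simp_all
  also have "(\<Sum>d\<in>{1..<Suc l}. g l (l - d) + g (l - d) l) = (\<Sum>j<l. g l j + g j l)"
    by (rule sum.reindex_bij_witness[where i = "\<lambda>j. l - j" and j = "\<lambda>d. l - d"]) auto
  finally show ?case
    using Suc.IH by (simp add: sum.distrib algebra_simps)
qed simp

lemma horner_sum_mult_horner_sum_inverse:
  fixes a b :: "'a :: comm_ring_1"
  assumes inverse: "a * b = 1" and len: "length xs = length ys"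
  shows "horner_sum f a xs * horner_sum g b ys = (\<Sum>i<length xs. f (xs ! i) * g (ys ! i)) +
    (\<Sum>d = 1..<length xs. a ^ d * (\<Sum>j<length xs - d. f (xs ! (j + d)) * g (ys ! j)) +
      b ^ d * (\<Sum>j<length xs - d. f (xs ! j) * g (ys ! (j + d))))"
proof -
  have pow: "a ^ j * b ^ j = 1" for j
    using inverse by (simp flip: power_mult_distrib)
  have shift_left: "a ^ (j + d) * b ^ j = a ^ d" for j d
    using pow[of j] by (simp add: power_add mult.assoc mult.left_commute[of "a ^ j"])
  have shift_right: "a ^ j * b ^ (j + d) = b ^ d" for j d
    using pow[of j] by (simp add: power_add flip: mult.assoc)
  have "horner_sum f a xs * horner_sum g b ys =
      (\<Sum>i<length xs. \<Sum>j<length xs. a ^ i * b ^ j * (f (xs ! i) * g (ys ! j)))"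
    by (simp add: horner_sum_eq_sum sum_product len lessThan_atLeast0 algebra_simps)
  also have "\<dots> = (\<Sum>i<length xs. f (xs ! i) * g (ys ! i)) +
      (\<Sum>d = 1..<length xs. \<Sum>j<length xs - d.
        a ^ d * (f (xs ! (j + d)) * g (ys ! j)) + b ^ d * (f (xs ! j) * g (ys ! (j + d))))"
    unfolding sum_square_diagonals by (simp add: pow shift_left shift_right)
  finally show ?thesis
    by (simp add: sum.distrib sum_distrib_left)
qed

context
  fixes a b :: "'a :: comm_ring_1" and \<phi> :: "complex \<Rightarrow> 'a"
  assumes inverse: "a * b = 1"
    and hom_add: "\<phi> (x + y) = \<phi> x + \<phi> y"
    and hom_mult: "\<phi> (x * y) = \<phi> x * \<phi> y"
    and hom_one: "\<phi> 1 = 1"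
begin

lemma hom_zero: "\<phi> 0 = 0"
  using hom_add[of 0 0] by simp

lemma horner_sum_mult_horner_sum_cnj:
  assumes unimodular: "\<And>z. z \<in> set A \<Longrightarrow> z * cnj z = 1"
  shows "horner_sum \<phi> a A * horner_sum (\<lambda>z. \<phi> (cnj z)) b A = of_nat (length A) +
    (\<Sum>d = 1..<length A. a ^ d * \<phi> (autocorr A d) + b ^ d * \<phi> (cnj (autocorr A d)))"
proof -
  have hom_sum: "\<phi> (\<Sum>j<k. h j) = (\<Sum>j<k. \<phi> (h j))" for h and k :: nat
    by (induction k) (simp_all add: hom_zero hom_add)
  have "\<phi> (A ! i) * \<phi> (cnj (A ! i)) = 1" if "i < length A" for i
    using unimodular[OF nth_mem[OF that]] by (metis hom_mult hom_one)
  then have "(\<Sum>i<length A. \<phi> (A ! i) * \<phi> (cnj (A ! i))) = of_nat (length A)"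
    by simp
  moreover have "(\<Sum>j<length A - d. \<phi> (A ! (j + d)) * \<phi> (cnj (A ! j))) = \<phi> (autocorr A d)" for d
    by (simp add: autocorr_def hom_sum hom_mult)
  moreover have "(\<Sum>j<length A - d. \<phi> (A ! j) * \<phi> (cnj (A ! (j + d)))) = \<phi> (cnj (autocorr A d))"
    for d
    by (simp add: autocorr_def hom_sum hom_mult mult.commute)
  ultimately show ?thesis
    by (simp add: horner_sum_mult_horner_sum_inverse[OF inverse])
qed

lemma horner_sum_complementary:
  assumes "length A = l" "length B = l" and compl: "complementary A B"
    and unimodular: "\<And>z. z \<in> set A \<union> set B \<Longrightarrow> z * cnj z = 1"
  shows "horner_sum \<phi> a A * horner_sum (\<lambda>z. \<phi> (cnj z)) b A +
    horner_sum \<phi> a B * horner_sum (\<lambda>z. \<phi> (cnj z)) b B = of_nat (2 * l)"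
proof -
  have lag: "\<phi> (autocorr A d) + \<phi> (autocorr B d) = 0"
    "\<phi> (cnj (autocorr A d)) + \<phi> (cnj (autocorr B d)) = 0" if "d > 0" for d
    using compl that
    by (simp_all add: complementary_def hom_zero flip: hom_add complex_cnj_add)
  have "horner_sum \<phi> a A * horner_sum (\<lambda>z. \<phi> (cnj z)) b A +
      horner_sum \<phi> a B * horner_sum (\<lambda>z. \<phi> (cnj z)) b B =
    of_nat (2 * l) + (\<Sum>d = 1..<l. a ^ d * (\<phi> (autocorr A d) + \<phi> (autocorr B d)) +
      b ^ d * (\<phi> (cnj (autocorr A d)) + \<phi> (cnj (autocorr B d))))"
    using assms by (simp add: horner_sum_mult_horner_sum_cnj sum.distrib algebra_simps)
  then show ?thesis
    by (simp add: lag)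
qed

end

definition laurent :: "int \<Rightarrow> 'a :: comm_ring_1 list \<Rightarrow> int \<Rightarrow>\<^sub>0 'a" where
  "laurent z xs = horner_sum (Poly_Mapping.single 0) (Poly_Mapping.single z 1) xs"

lemma single_power:
  "Poly_Mapping.single k x ^ i = Poly_Mapping.single (of_nat i * k) (x ^ i)"
  for k :: "'b :: semiring_1" and x :: "'a :: semiring_1"
  by (induction i) (simp_all add: mult_single distrib_right)

lemma laurent_eq_sum:
  "laurent z xs = (\<Sum>i<length xs. Poly_Mapping.single (z * int i) (xs ! i))"
  by (simp add: laurent_def horner_sum_eq_sum single_power mult_single mult.commute
      lessThan_atLeast0)

lemma horner_sum_map_scale:
  fixes a c :: "'a :: comm_semiring_0"
  assumes "\<And>x. x \<in> set xs \<Longrightarrow> f (h x) = c * g x"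
  shows "horner_sum f a (map h xs) = c * horner_sum g a xs"
  using assms by (induction xs) (simp_all add: distrib_left mult.left_commute)

lemma laurent_concat:
  "laurent z (concat (map xs [0..<n])) =
    (\<Sum>v<n. Poly_Mapping.single (z * int (\<Sum>u<v. length (xs u))) 1 * laurent z (xs v))"
proof (induction n)
  case (Suc n)
  have "length (concat (map xs [0..<n])) = (\<Sum>u<n. length (xs u))"
    by (induction n) simp_all
  with Suc.IH show ?case
    by (simp add: laurent_def horner_sum_append single_power mult.commute)
qed (simp add: laurent_def)

definition sylvester_concat :: "nat \<Rightarrow> (nat \<Rightarrow> 'a :: comm_ring_1 list) \<Rightarrow> nat \<Rightarrow> 'a list" where
  "sylvester_concat e xs h = concat (map (\<lambda>v. map ((*) (sylvester h v)) (xs v)) [0..<2 ^ e])"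

lemma length_sylvester_concat: "length (sylvester_concat e xs h) = (\<Sum>v<2 ^ e. length (xs v))"
  by (simp add: sylvester_concat_def length_concat comp_def sum_list_sum_nth lessThan_atLeast0)

lemma set_sylvester_concat:
  assumes "\<And>x. x \<in> T \<Longrightarrow> - x \<in> T" and "\<And>v. v < 2 ^ e \<Longrightarrow> set (xs v) \<subseteq> T"
  shows "set (sylvester_concat e xs h) \<subseteq> T"
proof -
  have "sylvester h v * x \<in> T" if "x \<in> T" for v x
    using that assms(1) by (simp add: sylvester_def walsh_mult)
  with assms(2) show ?thesis
    by (fastforce simp: sylvester_concat_def)
qed

lemma laurent_sylvester_concat:
  "laurent z (sylvester_concat e xs h) = (\<Sum>v<2 ^ e. sylvester h v *
    (Poly_Mapping.single (z * int (\<Sum>u<v. length (xs u))) 1 * laurent z (xs v)))"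
proof -
  have "Poly_Mapping.single 0 (walsh S U * x) = walsh S U * Poly_Mapping.single 0 x"
    for S U :: "nat set" and x :: 'a
    by (simp add: walsh_mult single_uminus)
  then have "laurent z (map ((*) (sylvester h v)) ys) = sylvester h v * laurent z ys"
    for v and ys :: "'a list"
    unfolding laurent_def sylvester_def by (intro horner_sum_map_scale)
  then show ?thesis
    by (simp add: sylvester_concat_def laurent_concat mult.left_commute)
qed

lemma sum_laurent_sylvester_concat:
  fixes xs ys :: "nat \<Rightarrow> 'a :: comm_ring_1 list"
  assumes "\<And>v. v < 2 ^ e \<Longrightarrow> length (ys v) = length (xs v)"
  shows "(\<Sum>h<2 ^ e. laurent 1 (sylvester_concat e xs h) * laurent (-1) (sylvester_concat e ys h)) =
    2 ^ e * (\<Sum>v<2 ^ e. laurent 1 (xs v) * laurent (-1) (ys v))"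
proof -
  define pos where "pos v = int (\<Sum>u<v. length (xs u))" for v
  have cancel_shift: "Poly_Mapping.single k 1 * x * (Poly_Mapping.single (- k) 1 * y) = x * y"
    for k :: int and x y :: "int \<Rightarrow>\<^sub>0 'a"
  proof -
    have "Poly_Mapping.single k 1 * x * (Poly_Mapping.single (- k) 1 * y) =
        Poly_Mapping.single k 1 * Poly_Mapping.single (- k) 1 * (x * y)"
      by (simp only: mult_ac)
    then show ?thesis by (simp add: mult_single)
  qed
  have pos_ys: "int (\<Sum>u<v. length (ys u)) = pos v" if "v < 2 ^ e" for v
    using that assms by (simp add: pos_def)
  have "(\<Sum>h<2 ^ e. laurent 1 (sylvester_concat e xs h) * laurent (-1) (sylvester_concat e ys h)) =
      (\<Sum>h<2 ^ e. (\<Sum>v<2 ^ e. sylvester h v * (Poly_Mapping.single (pos v) 1 * laurent 1 (xs v))) *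
        (\<Sum>v<2 ^ e. sylvester h v * (Poly_Mapping.single (- pos v) 1 * laurent (-1) (ys v))))"
    unfolding laurent_sylvester_concat pos_def[symmetric]
    by (intro sum.cong arg_cong2[where f = "(*)"] refl)
      (auto simp: pos_ys simp flip: minus_mult_left simp del: of_nat_sum)
  also have "\<dots> = 2 ^ e * (\<Sum>v<2 ^ e. Poly_Mapping.single (pos v) 1 * laurent 1 (xs v) *
      (Poly_Mapping.single (- pos v) 1 * laurent (-1) (ys v)))"
    by (rule sum_sylvester_combinations)
  finally show ?thesis
    by (simp only: cancel_shift)
qed

subsection \<open>Index matrices and circulants\<close>

definition matprod ::
  "'j set \<Rightarrow> ('i \<Rightarrow> 'j \<Rightarrow> 'a) \<Rightarrow> ('j \<Rightarrow> 'k \<Rightarrow> 'a) \<Rightarrow> 'i \<Rightarrow> 'k \<Rightarrow> 'a :: comm_semiring_0" where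
  "matprod J F G x z = (\<Sum>y\<in>J. F x y * G y z)"

definition circulant :: "nat \<Rightarrow> (int \<Rightarrow>\<^sub>0 'a) \<Rightarrow> int \<Rightarrow> int \<Rightarrow> 'a :: comm_ring_1" where
  "circulant M L t u =
    (\<Sum>k\<in>Poly_Mapping.keys L. if int M dvd u - t - k then Poly_Mapping.lookup L k else 0)"

lemma circulant_eq_sum_superset:
  assumes "finite K" "Poly_Mapping.keys L \<subseteq> K"
  shows "circulant M L t u = (\<Sum>k\<in>K. if int M dvd u - t - k then Poly_Mapping.lookup L k else 0)"
  unfolding circulant_def
  by (rule sum.mono_neutral_left) (use assms in \<open>auto simp: in_keys_iff\<close>)

lemma circulant_single:
  "circulant M (Poly_Mapping.single k x) t u = (if int M dvd u - t - k then x else 0)"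
  by (simp add: circulant_eq_sum_superset[where K = "{k}"])

lemma circulant_add: "circulant M (L + L') t u = circulant M L t u + circulant M L' t u"
proof -
  let ?K = "Poly_Mapping.keys L \<union> Poly_Mapping.keys L'"
  have "circulant M (L + L') t u =
      (\<Sum>k\<in>?K. (if int M dvd u - t - k then Poly_Mapping.lookup L k else 0) +
      (if int M dvd u - t - k then Poly_Mapping.lookup L' k else 0))"
    by (subst circulant_eq_sum_superset[where K = ?K])
      (auto simp: keys_add lookup_add intro!: sum.cong)
  then show ?thesis
    by (simp add: sum.distrib circulant_eq_sum_superset[where K = ?K])
qed

lemma circulant_sum: "circulant M (\<Sum>x\<in>A. L x) t u = (\<Sum>x\<in>A. circulant M (L x) t u)"
  by (induction A rule: infinite_finite_induct)
    (simp_all add: circulant_add, simp_all add: circulant_def)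

lemma poly_mapping_eq_sum_single:
  "L = (\<Sum>k\<in>Poly_Mapping.keys L. Poly_Mapping.single k (Poly_Mapping.lookup L k))"
  by (rule poly_mapping_eqI) (simp add: lookup_sum lookup_single when_def in_keys_iff)

lemma circulant_single_mult:
  "circulant M (Poly_Mapping.single k x * L) t u = x * circulant M L (t + k) u"
proof -
  have "Poly_Mapping.single k x * L = (\<Sum>k'\<in>Poly_Mapping.keys L.
      Poly_Mapping.single (k + k') (x * Poly_Mapping.lookup L k'))"
    by (subst poly_mapping_eq_sum_single) (simp only: sum_distrib_left mult_single)
  then show ?thesis
    by (simp add: circulant_sum circulant_single sum_distrib_left circulant_def[of M L]
        diff_diff_eq if_distrib add.assoc cong: if_cong)
qed

lemma matprod_circulant:
  fixes L L' :: "int \<Rightarrow>\<^sub>0 'a :: comm_ring_1"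
  assumes "M > 0"
  shows "matprod {0..<int M} (circulant M L) (circulant M L') t u = circulant M (L * L') t u"
proof -
  have periodic: "circulant M L' (s mod int M) u = circulant M L' s u" for s
  proof -
    have "u - s mod int M - k = u - s - k + s div int M * int M" for k
      by (simp add: algebra_simps flip: minus_div_mult_eq_mod)
    then have "int M dvd u - s mod int M - k \<longleftrightarrow> int M dvd u - s - k" for k
      by (metis dvd_add_times_triv_right_iff)
    then show ?thesis
      by (simp add: circulant_def)
  qed
  have residue: "int M dvd w - t - k \<longleftrightarrow> w = (t + k) mod int M" if "w \<in> {0..<int M}" for w k
    using that by (metis atLeastLessThan_iff diff_diff_eq mod_eq_dvd_iff mod_pos_pos_trivial)
  have "matprod {0..<int M} (circulant M L) (circulant M L') t u =
      (\<Sum>k\<in>Poly_Mapping.keys L. \<Sum>w\<in>{0..<int M}.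
        (if int M dvd w - t - k then Poly_Mapping.lookup L k else 0) * circulant M L' w u)"
    unfolding matprod_def circulant_def[of M L] sum_distrib_right by (rule sum.swap)
  also have "\<dots> = (\<Sum>k\<in>Poly_Mapping.keys L. \<Sum>w\<in>{0..<int M}.
      if w = (t + k) mod int M then Poly_Mapping.lookup L k * circulant M L' w u else 0)"
    by (intro sum.cong refl) (simp add: residue)
  also have "\<dots> = (\<Sum>k\<in>Poly_Mapping.keys L. Poly_Mapping.lookup L k * circulant M L' (t + k) u)"
    using assms by (simp add: periodic)
  also have "\<dots> = circulant M (\<Sum>k\<in>Poly_Mapping.keys L.
      Poly_Mapping.single k (Poly_Mapping.lookup L k) * L') t u"
    by (simp only: circulant_sum circulant_single_mult)
  also have "\<dots> = circulant M (L * L') t u"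
    by (simp only: poly_mapping_eq_sum_single[symmetric] flip: sum_distrib_right)
  finally show ?thesis .
qed

lemma circulant_laurent:
  assumes M_pos: "M > 0" and len: "length xs = M" and z_square: "z * z = 1"
  shows "circulant M (laurent z xs) t u = xs ! nat (z * (u - t) mod int M)"
proof -
  have "int M dvd u - t - z * int i \<longleftrightarrow> i = nat (z * (u - t) mod int M)" if "i < M" for i
  proof -
    have "u - t - z * int i = z * (z * (u - t) - int i)"
      using z_square by (simp add: right_diff_distrib flip: mult.assoc)
    moreover have "z dvd 1"
      using z_square by (metis dvd_triv_left)
    ultimately have "int M dvd u - t - z * int i \<longleftrightarrow> int M dvd z * (u - t) - int i"
      by (simp add: dvd_mult_unit_iff')
    also have "\<dots> \<longleftrightarrow> z * (u - t) mod int M = int i"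
      using that by (simp add: mod_eq_dvd_iff[symmetric])
    also have "\<dots> \<longleftrightarrow> i = nat (z * (u - t) mod int M)"
      using M_pos by auto
    finally show ?thesis .
  qed
  then have "circulant M (laurent z xs) t u =
      (\<Sum>i<M. if i = nat (z * (u - t) mod int M) then xs ! i else 0)"
    by (simp add: laurent_eq_sum circulant_sum circulant_single len cong: sum.cong_simp)
  moreover have "nat (z * (u - t) mod int M) < M"
    using M_pos by (simp add: nat_less_iff)
  ultimately show ?thesis by simp
qed

subsection \<open>Anticommuting matrices\<close>

definition toggle :: "'b \<Rightarrow> 'b set \<Rightarrow> 'b set" where
  "toggle c S = {x. (x \<in> S) \<noteq> (x = c)}"

lemma mem_toggle: "x \<in> toggle c S \<longleftrightarrow> (x \<in> S) \<noteq> (x = c)"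
  by (simp add: toggle_def)

lemma toggle_toggle [simp]: "toggle c (toggle c S) = S"
  by (auto simp: mem_toggle)

lemma toggle_commute: "toggle c (toggle d S) = toggle d (toggle c S)"
  by (auto simp: mem_toggle)

lemma toggle_subset: "c \<in> A \<Longrightarrow> S \<subseteq> A \<Longrightarrow> toggle c S \<subseteq> A"
  by (auto simp: mem_toggle)

lemma walsh_toggle:
  assumes "finite U"
  shows "walsh (toggle c S) U = (if c \<in> U then - walsh S U else walsh S U)"
proof (cases "c \<in> U")
  case True
  have "(\<Prod>x\<in>U - {c}. if x \<in> toggle c S then -1 else (1 :: 'b)) =
      (\<Prod>x\<in>U - {c}. if x \<in> S then -1 else 1)"
    by (intro prod.cong) (auto simp: mem_toggle)
  with assms True show ?thesis
    by (simp add: walsh_eq_prod prod.remove mem_toggle)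
next
  case False
  with assms show ?thesis
    by (auto simp: walsh_eq_prod mem_toggle intro!: prod.cong)
qed

lemma xor_less_power2:
  fixes a b :: nat
  assumes "a < 2 ^ e" "b < 2 ^ e"
  shows "xor a b < 2 ^ e"
  by (metis assms take_bit_nat_eq_self_iff take_bit_xor)

lemma xor_cancel_left: "xor a (xor a b) = (b :: nat)"
  by (simp flip: xor.assoc)

lemma sum_xor:
  fixes a :: nat
  assumes "a < 2 ^ e"
  shows "(\<Sum>b<2 ^ e. g (xor a b)) = (\<Sum>b<2 ^ e. g b)"
  by (rule sum.reindex_bij_witness[where i = "xor a" and j = "xor a"])
    (use assms in \<open>auto simp: xor_less_power2 xor_cancel_left\<close>)

text \<open>Substituting \<open>xor d b\<close> for \<open>b\<close> only shows that the sum is its own negative; splitting by a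
  bit of \<open>d\<close> avoids dividing by 2.\<close>

lemma sum_eq_0_if_xor_antisymmetric:
  fixes g :: "nat \<Rightarrow> 'a :: ab_group_add"
  assumes "d < 2 ^ e" "d \<noteq> 0"
    and anti: "\<And>b. b < 2 ^ e \<Longrightarrow> g (xor d b) = - g b"
  shows "(\<Sum>b<2 ^ e. g b) = 0"
proof -
  obtain i where bit_i: "bit d i"
    using assms(2) by (metis bit_eq_iff bit_0_eq bot_apply bot_bool_def)
  have "(\<Sum>b<2 ^ e. g b) =
      (\<Sum>b | b < 2 ^ e \<and> bit b i. g b) + (\<Sum>b | b < 2 ^ e \<and> \<not> bit b i. g b)"
    by (subst sum.union_disjoint[symmetric]) (auto intro: sum.cong)
  also have "(\<Sum>b | b < 2 ^ e \<and> \<not> bit b i. g b) = (\<Sum>b | b < 2 ^ e \<and> bit b i. g (xor d b))"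
    by (rule sum.reindex_bij_witness[where i = "xor d" and j = "xor d"])
      (use bit_i assms(1) in \<open>auto simp: bit_xor_iff xor_less_power2 xor_cancel_left\<close>)
  also have "\<dots> = (\<Sum>b | b < 2 ^ e \<and> bit b i. - g b)"
    by (intro sum.cong) (simp_all add: anti)
  finally show ?thesis
    by (simp add: sum_negf)
qed

lemma sum_xor_antisymmetric:
  fixes h :: "nat \<Rightarrow> nat \<Rightarrow> 'a :: ab_group_add"
  assumes anti: "\<And>c d. c < 2 ^ e \<Longrightarrow> d < 2 ^ e \<Longrightarrow> c \<noteq> d \<Longrightarrow> h c d = - h d c"
    and less: "a < 2 ^ e" "a' < 2 ^ e"
  shows "(\<Sum>b<2 ^ e. h (xor a b) (xor a' b)) = (if a = a' then \<Sum>c<2 ^ e. h c c else 0)"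
proof (cases "a = a'")
  case True
  then show ?thesis
    using sum_xor[OF less(1), of "\<lambda>c. h c c"] by simp
next
  case False
  have "(\<Sum>b<2 ^ e. h (xor a b) (xor a' b)) = 0"
  proof (rule sum_eq_0_if_xor_antisymmetric[where d = "xor a a'"])
    show "xor a a' < 2 ^ e"
      by (rule xor_less_power2[OF less])
    show "xor a a' \<noteq> 0"
      using False by (metis xor.right_neutral xor_cancel_left)
    fix b :: nat assume "b < 2 ^ e"
    moreover have "xor a' b \<noteq> xor a b"
      using False by (metis xor.commute xor_cancel_left)
    ultimately have "h (xor a' b) (xor a b) = - h (xor a b) (xor a' b)"
      by (intro anti xor_less_power2 less)
    then show "h (xor a (xor (xor a a') b)) (xor a' (xor (xor a a') b)) = - h (xor a b) (xor a' b)"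
      by (simp add: xor.assoc xor_cancel_left xor.left_commute[of a'])
  qed
  with False show ?thesis by simp
qed

definition design_index :: "nat \<Rightarrow> nat \<Rightarrow> (nat \<times> nat set \<times> int) set" where
  "design_index e M = {..<2 ^ e} \<times> Pow {..<2 ^ e} \<times> {0..<int M}"

lemma finite_design_index: "finite (design_index e M)"
  by (simp add: design_index_def)

lemma card_design_index: "card (design_index e M) = 2 ^ (2 ^ e + e) * M"
  by (simp add: design_index_def card_cartesian_product card_Pow power_add)

locale odd_involution =
  fixes star :: "'a :: comm_ring_1 \<Rightarrow> 'a"
  assumes star_star [simp]: "star (star x) = x"
    and star_minus [simp]: "star (- x) = - star x"
begin

lemma star_walsh_mult: "star (walsh S U * x) = walsh S U * star x"
  by (simp add: walsh_mult)

definition adj :: "('i \<Rightarrow> 'j \<Rightarrow> 'a) \<Rightarrow> 'j \<Rightarrow> 'i \<Rightarrow> 'a" where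
  "adj F y x = star (F x y)"

definition xor_block :: "(nat \<Rightarrow> 'i \<Rightarrow> 'j \<Rightarrow> 'a) \<Rightarrow> nat \<times> 'i \<Rightarrow> nat \<times> 'j \<Rightarrow> 'a" where
  "xor_block E = (\<lambda>(a, x) (b, y). E (xor a b) x y)"

lemma xor_block_mult_adj:
  assumes anti: "\<And>c d x y. c < 2 ^ e \<Longrightarrow> d < 2 ^ e \<Longrightarrow> c \<noteq> d \<Longrightarrow> x \<in> I \<Longrightarrow> y \<in> I \<Longrightarrow>
      matprod J (E c) (adj (E d)) x y = - matprod J (E d) (adj (E c)) x y"
    and squares: "\<And>x y. x \<in> I \<Longrightarrow> y \<in> I \<Longrightarrow>
      (\<Sum>c<2 ^ e. matprod J (E c) (adj (E c)) x y) = (if x = y then f else 0)"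
    and mem: "p \<in> {..<2 ^ e} \<times> I" "q \<in> {..<2 ^ e} \<times> I"
  shows "matprod ({..<2 ^ e} \<times> J) (xor_block E) (adj (xor_block E)) p q = (if p = q then f else 0)"
proof -
  obtain a x a' y where coords: "p = (a, x)" "q = (a', y)" by (cases p, cases q)
  then have "a < 2 ^ e" "a' < 2 ^ e" "x \<in> I" "y \<in> I"
    using mem by auto
  then have "(\<Sum>b<2 ^ e. matprod J (E (xor a b)) (adj (E (xor a' b))) x y) =
      (if a = a' then \<Sum>c<2 ^ e. matprod J (E c) (adj (E c)) x y else 0)"
    by (intro sum_xor_antisymmetric anti)
  also have "\<dots> = (if p = q then f else 0)"
    using \<open>x \<in> I\<close> \<open>y \<in> I\<close> by (simp add: coords squares)
  finally show ?thesis
    by (simp add: coords matprod_def adj_def xor_block_def sum.cartesian_product')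
qed

definition oriented :: "(nat \<Rightarrow> 'i \<Rightarrow> 'i \<Rightarrow> 'a) \<Rightarrow> nat \<Rightarrow> nat set \<Rightarrow> 'i \<Rightarrow> 'i \<Rightarrow> 'a" where
  "oriented K c S = (if c \<in> S then adj (K c) else K c)"

text \<open>The factor \<open>walsh S {..<c}\<close> is the Jordan--Wigner sign. The factor \<open>walsh (toggle c S) U\<close>
  comes from multiplying on the right by a Sylvester matrix the matrix whose only nonzero entries in
  row \<open>S\<close> are those in column \<open>toggle c S\<close>.\<close>

definition jordan_wigner ::
  "(nat \<Rightarrow> 'i \<Rightarrow> 'i \<Rightarrow> 'a) \<Rightarrow> nat \<Rightarrow> nat set \<times> 'i \<Rightarrow> nat set \<times> 'i \<Rightarrow> 'a" where
  "jordan_wigner K c = (\<lambda>(S, t) (U, u).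
     walsh S {..<c} * (walsh (toggle c S) U * oriented K c S t u))"

lemma adj_oriented: "adj (oriented K c S) = oriented K c (toggle c S)"
  by (auto simp: oriented_def adj_def mem_toggle fun_eq_iff)

lemma jordan_wigner_mult_adj:
  assumes "S \<subseteq> {..<p}" "T \<subseteq> {..<p}" "c < p" "d < p"
  shows "matprod (Pow {..<p} \<times> I) (jordan_wigner K c) (adj (jordan_wigner K d)) (S, t) (T, u) =
    (if toggle c S = toggle d T
     then 2 ^ p * (walsh S {..<c} * walsh T {..<d} *
       matprod I (oriented K c S) (oriented K d (toggle c S)) t u)
     else 0)"
proof -
  have star_jordan_wigner: "star (jordan_wigner K d (T, u) (V, v)) =
      walsh T {..<d} * (walsh (toggle d T) V * oriented K d (toggle d T) v u)" for V v
    by (simp add: jordan_wigner_def star_walsh_mult adj_def flip: adj_oriented)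
  have "matprod (Pow {..<p} \<times> I) (jordan_wigner K c) (adj (jordan_wigner K d)) (S, t) (T, u) =
      (\<Sum>V\<in>Pow {..<p}. \<Sum>v\<in>I. walsh S {..<c} * walsh T {..<d} *
        ((walsh (toggle c S) V * walsh (toggle d T) V) *
         (oriented K c S t v * oriented K d (toggle d T) v u)))"
    unfolding matprod_def adj_def star_jordan_wigner sum.cartesian_product'
    by (simp add: jordan_wigner_def mult_ac)
  also have "\<dots> = walsh S {..<c} * walsh T {..<d} *
      ((\<Sum>V\<in>Pow {..<p}. walsh (toggle c S) V * walsh (toggle d T) V) *
       matprod I (oriented K c S) (oriented K d (toggle d T)) t u)"
    unfolding matprod_def sum_product by (simp add: sum_distrib_left)
  finally show ?thesis
    using assms by (simp add: sum_walsh_mult_walsh toggle_subset mult_ac)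
qed

lemma jordan_wigner_anticommute:
  assumes commute: "\<And>S. matprod I (oriented K c S) (oriented K d S) t u =
      matprod I (oriented K d S) (oriented K c S) t u"
    and "S \<subseteq> {..<p}" "T \<subseteq> {..<p}" "c < p" "d < p" "c \<noteq> d"
  shows "matprod (Pow {..<p} \<times> I) (jordan_wigner K c) (adj (jordan_wigner K d)) (S, t) (T, u) =
    - matprod (Pow {..<p} \<times> I) (jordan_wigner K d) (adj (jordan_wigner K c)) (S, t) (T, u)"
proof (cases "T = toggle d (toggle c S)")
  case True
  have "oriented K d (toggle c S) = oriented K d S" "oriented K c (toggle d S) = oriented K c S"
    using \<open>c \<noteq> d\<close> by (auto simp: oriented_def mem_toggle)
  moreover have "walsh S {..<c} * walsh T {..<d} = - (walsh S {..<d} * walsh T {..<c} :: 'a)"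
    using \<open>c \<noteq> d\<close> by (auto simp: True walsh_toggle)
  moreover have "toggle d T = toggle c S" "toggle c T = toggle d S"
    by (simp_all add: True toggle_commute)
  ultimately show ?thesis
    using assms by (simp add: jordan_wigner_mult_adj)
next
  case False
  then have "toggle c S \<noteq> toggle d T" "toggle d S \<noteq> toggle c T"
    by (metis toggle_toggle toggle_commute)+
  with assms show ?thesis
    by (simp add: jordan_wigner_mult_adj)
qed

lemma jordan_wigner_mult_adj_self:
  assumes normal: "matprod I (K c) (adj (K c)) t u = matprod I (adj (K c)) (K c) t u"
    and "S \<subseteq> {..<p}" "T \<subseteq> {..<p}" "c < p"
  shows "matprod (Pow {..<p} \<times> I) (jordan_wigner K c) (adj (jordan_wigner K c)) (S, t) (T, u) =
    (if S = T then 2 ^ p * matprod I (K c) (adj (K c)) t u else 0)"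
proof -
  have "matprod I (oriented K c S) (oriented K c (toggle c S)) t u = matprod I (K c) (adj (K c)) t u"
    using normal by (simp add: oriented_def mem_toggle)
  moreover have "toggle c S = toggle c T \<longleftrightarrow> S = T"
    by (metis toggle_toggle)
  ultimately show ?thesis
    using assms by (auto simp: jordan_wigner_mult_adj walsh_self_mult)
qed

lemma xor_block_jordan_wigner_mult_adj:
  fixes e :: nat and I :: "'i set"
  defines "R \<equiv> {..<2 ^ e} \<times> Pow {..<2 ^ e} \<times> I"
  assumes commute: "\<And>c d S T t u. c < 2 ^ e \<Longrightarrow> d < 2 ^ e \<Longrightarrow> t \<in> I \<Longrightarrow> u \<in> I \<Longrightarrow>
      matprod I (oriented K c S) (oriented K d T) t u =
      matprod I (oriented K d T) (oriented K c S) t u"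
    and squares: "\<And>t u. t \<in> I \<Longrightarrow> u \<in> I \<Longrightarrow>
      (\<Sum>c<2 ^ e. matprod I (K c) (adj (K c)) t u) = (if t = u then f else 0)"
    and "p \<in> R" "q \<in> R"
  shows "matprod R (xor_block (jordan_wigner K)) (adj (xor_block (jordan_wigner K))) p q =
    (if p = q then 2 ^ 2 ^ e * f else 0)"
  unfolding R_def
proof (rule xor_block_mult_adj)
  let ?J = "Pow {..<2 ^ e :: nat} \<times> I"
  show "matprod ?J (jordan_wigner K c) (adj (jordan_wigner K d)) x y =
      - matprod ?J (jordan_wigner K d) (adj (jordan_wigner K c)) x y"
    if "c < 2 ^ e" "d < 2 ^ e" "c \<noteq> d" "x \<in> ?J" "y \<in> ?J" for c d x y
    using that by (cases x, cases y) (auto intro!: jordan_wigner_anticommute commute)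
  fix x y assume "x \<in> ?J" "y \<in> ?J"
  then obtain S t T u where coords: "x = (S, t)" "y = (T, u)"
    and mem: "S \<subseteq> {..<2 ^ e}" "T \<subseteq> {..<2 ^ e}" "t \<in> I" "u \<in> I" by auto
  have normal: "matprod I (K c) (adj (K c)) t u = matprod I (adj (K c)) (K c) t u"
    if "c < 2 ^ e" for c
    using commute[OF that that mem(3,4), of "{}" "{c}"] by (simp add: oriented_def)
  have "(\<Sum>c<2 ^ e. matprod ?J (jordan_wigner K c) (adj (jordan_wigner K c)) x y) =
      (\<Sum>c<2 ^ e. if S = T then 2 ^ 2 ^ e * matprod I (K c) (adj (K c)) t u else 0)"
    unfolding coords using mem
    by (intro sum.cong refl jordan_wigner_mult_adj_self normal) simp_all
  also have "\<dots> = (if S = T then 2 ^ 2 ^ e * (\<Sum>c<2 ^ e. matprod I (K c) (adj (K c)) t u) else 0)"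
    by (simp add: sum_distrib_left)
  finally show "(\<Sum>c<2 ^ e. matprod ?J (jordan_wigner K c) (adj (jordan_wigner K c)) x y) =
      (if x = y then 2 ^ 2 ^ e * f else 0)"
    using mem by (simp add: squares coords)
qed (use assms in \<open>simp_all add: R_def\<close>)

text \<open>For \<open>j \<ge> 0\<close> the coefficient at \<open>j\<close> is the non-periodic autocorrelation at \<open>j\<close>.\<close>

definition autocorr_poly :: "'a list \<Rightarrow> int \<Rightarrow>\<^sub>0 'a" where
  "autocorr_poly xs = laurent 1 xs * laurent (-1) (map star xs)"

lemma sum_autocorr_poly_sylvester_concat:
  "(\<Sum>h<2 ^ e. autocorr_poly (sylvester_concat e xs h)) = 2 ^ e * (\<Sum>v<2 ^ e. autocorr_poly (xs v))"
proof -
  have "map star (sylvester_concat e xs h) = sylvester_concat e (\<lambda>v. map star (xs v)) h" for h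
    by (simp add: sylvester_concat_def map_concat comp_def sylvester_def star_walsh_mult)
  then show ?thesis
    by (simp add: autocorr_poly_def sum_laurent_sylvester_concat)
qed

lemma adj_circulant_laurent:
  assumes "M > 0" "length xs = M"
  shows "adj (circulant M (laurent 1 xs)) = circulant M (laurent (-1) (map star xs))"
proof (intro ext)
  fix t u :: int
  have "nat ((t - u) mod int M) < M"
    using assms by (simp add: nat_less_iff)
  with assms show "adj (circulant M (laurent 1 xs)) t u = circulant M (laurent (-1) (map star xs)) t u"
    by (simp add: adj_def circulant_laurent)
qed

definition circulant_design :: "nat \<Rightarrow> (nat \<Rightarrow> 'a list) \<Rightarrow>
    nat \<times> nat set \<times> int \<Rightarrow> nat \<times> nat set \<times> int \<Rightarrow> 'a" where
  "circulant_design M xs = xor_block (jordan_wigner (\<lambda>c. circulant M (laurent 1 (xs c))))"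

lemma circulant_design_mem:
  assumes closed: "\<And>x. x \<in> T \<Longrightarrow> - x \<in> T" "\<And>x. x \<in> T \<Longrightarrow> star x \<in> T"
    and M_pos: "M > 0" and len: "\<And>c. c < 2 ^ e \<Longrightarrow> length (xs c) = M"
    and sub: "\<And>c. c < 2 ^ e \<Longrightarrow> set (xs c) \<subseteq> T"
    and mem: "p \<in> design_index e M" "q \<in> design_index e M"
  shows "circulant_design M xs p q \<in> T"
proof -
  obtain a S t b U u where coords: "p = (a, S, t)" "q = (b, U, u)" by (cases p, cases q)
  define c where "c = xor a b"
  have c_less: "c < 2 ^ e"
    using mem by (auto simp: c_def coords design_index_def xor_less_power2)
  have "circulant M (laurent 1 (xs c)) t u \<in> T" for t u
  proof -
    have "nat ((u - t) mod int M) < length (xs c)"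
      using M_pos len[OF c_less] by (simp add: nat_less_iff)
    then show ?thesis
      using M_pos len[OF c_less] sub[OF c_less] by (auto simp: circulant_laurent)
  qed
  then have "oriented (\<lambda>c. circulant M (laurent 1 (xs c))) c S t u \<in> T"
    using closed(2) by (simp add: oriented_def adj_def)
  then show ?thesis
    using closed(1)
    by (simp add: circulant_design_def xor_block_def jordan_wigner_def coords walsh_mult c_def)
qed

lemma circulant_design_mult_adj:
  assumes M_pos: "M > 0" and len: "\<And>c. c < 2 ^ e \<Longrightarrow> length (xs c) = M"
    and compl: "(\<Sum>c<2 ^ e. autocorr_poly (xs c)) = Poly_Mapping.single 0 f"
    and "p \<in> design_index e M" "q \<in> design_index e M"
  shows "matprod (design_index e M) (circulant_design M xs) (adj (circulant_design M xs)) p q =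
    (if p = q then 2 ^ 2 ^ e * f else 0)"
  unfolding circulant_design_def design_index_def
proof (rule xor_block_jordan_wigner_mult_adj)
  let ?I = "{0..<int M}"
  let ?K = "\<lambda>c. circulant M (laurent 1 (xs c))"
  have adj_K: "adj (?K c) = circulant M (laurent (-1) (map star (xs c)))" if "c < 2 ^ e" for c
    by (rule adj_circulant_laurent[OF M_pos len[OF that]])
  have "\<exists>L. oriented ?K c S = circulant M L" if "c < 2 ^ e" for c S
    using that by (auto simp: oriented_def adj_K)
  then show "matprod ?I (oriented ?K c S) (oriented ?K d T) t u =
      matprod ?I (oriented ?K d T) (oriented ?K c S) t u" if "c < 2 ^ e" "d < 2 ^ e" for c d S T t u
    using that by (metis matprod_circulant[OF M_pos] mult.commute)
  fix t u assume mem: "t \<in> ?I" "u \<in> ?I"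
  have "matprod ?I (?K c) (adj (?K c)) t u = circulant M (autocorr_poly (xs c)) t u"
    if "c < 2 ^ e" for c
    unfolding adj_K[OF that] by (simp add: matprod_circulant[OF M_pos] autocorr_poly_def)
  then have "(\<Sum>c<2 ^ e. matprod ?I (?K c) (adj (?K c)) t u) =
      circulant M (Poly_Mapping.single 0 f) t u"
    by (simp add: circulant_sum flip: compl)
  also have "\<dots> = (if t = u then f else 0)"
    using mem by (auto simp: circulant_single simp flip: mod_eq_dvd_iff)
  finally show "(\<Sum>c<2 ^ e. matprod ?I (?K c) (adj (?K c)) t u) = (if t = u then f else 0)" .
qed (use assms in \<open>simp_all add: design_index_def\<close>)

end

subsection \<open>Complex orthogonal designs\<close>

interpretation cpoly: odd_involution "Poly_Mapping.map cnj :: cpoly \<Rightarrow> cpoly"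
  by unfold_locales (auto intro!: poly_mapping_eqI simp: Poly_Mapping.map.rep_eq when_def)

definition unit_terms :: "nat \<Rightarrow> cpoly set" where
  "unit_terms t = {cterm u j | u j. u \<in> {1, -1, \<i>, -\<i>} \<and> j < t}"

lemma uminus_mem_unit_terms: "x \<in> unit_terms t \<Longrightarrow> - x \<in> unit_terms t"
  unfolding unit_terms_def cterm_def by (force simp flip: single_uminus)

lemma cnj_mem_unit_terms: "x \<in> unit_terms t \<Longrightarrow> Poly_Mapping.map cnj x \<in> unit_terms t"
  unfolding unit_terms_def cterm_def by force

lemma is_COD_if_rows_orthogonal:
  fixes F :: "'b \<Rightarrow> 'b \<Rightarrow> cpoly"
  assumes fin: "finite I" and card: "card I = N"
    and pos: "\<And>c. c \<in> set cs \<Longrightarrow> c > 0"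
    and entries: "\<And>x y. x \<in> I \<Longrightarrow> y \<in> I \<Longrightarrow> F x y \<in> unit_terms (length cs)"
    and rows: "\<And>x y. x \<in> I \<Longrightarrow> y \<in> I \<Longrightarrow> matprod I F (cpoly.adj F) x y =
      (if x = y then (\<Sum>j<length cs. of_nat (cs ! j) * (var j)\<^sup>2) else 0)"
  shows "\<exists>X. is_COD N cs X"
proof -
  let ?s = "\<Sum>j<length cs. of_nat (cs ! j) * (var j)\<^sup>2"
  obtain g where bij_g: "bij_betw g {0..<N} I"
    using ex_bij_betw_nat_finite[OF fin] card by auto
  then have g_mem: "g i \<in> I" if "i < N" for i
    using that by (simp add: bij_betw_apply)
  define X where "X = mat N N (\<lambda>(i, j). F (g i) (g j))"
  have "elements_mat X \<subseteq> unit_terms (length cs)"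
    using entries g_mem by (auto simp: X_def elements_mat_def)
  moreover have "X * conj_transpose X = ?s \<cdot>\<^sub>m 1\<^sub>m N"
  proof (rule eq_matI)
    fix i j
    assume "i < dim_row (?s \<cdot>\<^sub>m 1\<^sub>m N)" "j < dim_col (?s \<cdot>\<^sub>m 1\<^sub>m N)"
    then have less: "i < N" "j < N" by simp_all
    have "(X * conj_transpose X) $$ (i, j) =
        (\<Sum>k\<in>{0..<N}. F (g i) (g k) * cpoly.adj F (g k) (g j))"
      using less by (simp add: X_def conj_transpose_def scalar_prod_def cpoly.adj_def)
    also have "\<dots> = matprod I F (cpoly.adj F) (g i) (g j)"
      unfolding matprod_def by (rule sum.reindex_bij_betw[OF bij_g])
    also have "\<dots> = (if g i = g j then ?s else 0)"
      by (simp add: rows g_mem less)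
    also have "g i = g j \<longleftrightarrow> i = j"
      using less bij_betw_imp_inj_on[OF bij_g] by (auto simp: inj_on_def)
    finally show "(X * conj_transpose X) $$ (i, j) = (?s \<cdot>\<^sub>m 1\<^sub>m N) $$ (i, j)"
      using less by simp
  qed (simp_all add: X_def conj_transpose_def)
  moreover have "X \<in> carrier_mat N N" by (simp add: X_def)
  ultimately show ?thesis
    unfolding is_COD_def unit_terms_def using pos by blast
qed

lemma exists_COD_of_complementary_sequences:
  fixes xs :: "nat \<Rightarrow> cpoly list"
  assumes M_pos: "M > 0" and len: "\<And>c. c < 2 ^ e \<Longrightarrow> length (xs c) = M"
    and entries: "\<And>c. c < 2 ^ e \<Longrightarrow> set (xs c) \<subseteq> unit_terms (length cs)"
    and compl: "(\<Sum>c<2 ^ e. cpoly.autocorr_poly (xs c)) = Poly_Mapping.single 0 f"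
    and weights: "(\<Sum>j<length cs. of_nat (cs ! j) * (var j)\<^sup>2) = 2 ^ 2 ^ e * f"
    and pos: "\<And>c. c \<in> set cs \<Longrightarrow> c > 0"
  shows "\<exists>X. is_COD (2 ^ (2 ^ e + e) * M) cs X"
proof (rule is_COD_if_rows_orthogonal[where I = "design_index e M"
      and F = "cpoly.circulant_design M xs"])
  fix p q :: "nat \<times> nat set \<times> int"
  assume mem: "p \<in> design_index e M" "q \<in> design_index e M"
  show "cpoly.circulant_design M xs p q \<in> unit_terms (length cs)"
    by (rule cpoly.circulant_design_mem
        [OF uminus_mem_unit_terms cnj_mem_unit_terms M_pos len entries mem])
  show "matprod (design_index e M) (cpoly.circulant_design M xs)
      (cpoly.adj (cpoly.circulant_design M xs)) p q =
    (if p = q then (\<Sum>j<length cs. of_nat (cs ! j) * (var j)\<^sup>2) else 0)"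
    unfolding weights by (rule cpoly.circulant_design_mult_adj[OF M_pos len compl mem])
qed (rule finite_design_index card_design_index pos | assumption)+

definition scale_by_var :: "nat \<Rightarrow> complex list \<Rightarrow> cpoly list" where
  "scale_by_var j A = map (\<lambda>z. cterm z j) A"

abbreviation const_laurent :: "complex \<Rightarrow> int \<Rightarrow>\<^sub>0 cpoly" where
  "const_laurent z \<equiv> Poly_Mapping.single 0 (Poly_Mapping.single 0 z)"

lemma autocorr_poly_scale_by_var:
  "cpoly.autocorr_poly (scale_by_var j A) = Poly_Mapping.single 0 ((var j)\<^sup>2) *
    (horner_sum const_laurent (Poly_Mapping.single 1 1) A *
     horner_sum (\<lambda>z. const_laurent (cnj z)) (Poly_Mapping.single (-1) 1) A)"
proof -
  let ?x = "Poly_Mapping.single 0 (var j) :: int \<Rightarrow>\<^sub>0 cpoly"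
  have "laurent 1 (scale_by_var j A) =
      ?x * horner_sum const_laurent (Poly_Mapping.single 1 1) A"
    unfolding laurent_def scale_by_var_def
    by (rule horner_sum_map_scale) (simp add: cterm_def mult_single)
  moreover have "laurent (-1) (map (Poly_Mapping.map cnj) (scale_by_var j A)) =
      ?x * horner_sum (\<lambda>z. const_laurent (cnj z)) (Poly_Mapping.single (-1) 1) A"
    unfolding laurent_def scale_by_var_def map_map comp_def
    by (rule horner_sum_map_scale) (simp add: cterm_def mult_single)
  moreover have "Poly_Mapping.single 0 ((var j)\<^sup>2) = ?x * ?x"
    by (simp add: mult_single power2_eq_square)
  ultimately show ?thesis
    by (simp only: cpoly.autocorr_poly_def mult_ac)
qed

lemma autocorr_poly_complex_golay_pair:
  assumes "complex_golay_pair l A B"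
  shows "cpoly.autocorr_poly (scale_by_var j A) + cpoly.autocorr_poly (scale_by_var j B) =
    Poly_Mapping.single 0 (of_nat (2 * l) * (var j)\<^sup>2)"
proof -
  have "z * cnj z = 1" if "z \<in> set A \<union> set B" for z
  proof -
    have "z \<in> {1, -1, \<i>, -\<i>}"
      using assms that unfolding complex_golay_pair_def by blast
    then show ?thesis by auto
  qed
  then have "cpoly.autocorr_poly (scale_by_var j A) + cpoly.autocorr_poly (scale_by_var j B) =
      Poly_Mapping.single 0 ((var j)\<^sup>2) * of_nat (2 * l)"
    unfolding autocorr_poly_scale_by_var distrib_left[symmetric]
    using assms by (subst horner_sum_complementary)
      (auto simp: complex_golay_pair_def mult_single single_add)
  also have "\<dots> = Poly_Mapping.single 0 (of_nat (2 * l) * (var j)\<^sup>2)"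
    by (metis mult_single single_of_nat mult.commute add_0)
  finally show ?thesis .
qed

definition golay_sequence ::
  "nat \<Rightarrow> (nat \<Rightarrow> nat) \<Rightarrow> (nat \<Rightarrow> complex list) \<Rightarrow> (nat \<Rightarrow> complex list) \<Rightarrow> nat \<Rightarrow> cpoly list" where
  "golay_sequence e w A B c =
    sylvester_concat e (\<lambda>v. scale_by_var (w v) (if even c then A v else B v)) (c div 2)"

lemma length_golay_sequence:
  assumes "\<And>v. v < 2 ^ e \<Longrightarrow> complex_golay_pair (l v) (A v) (B v)"
  shows "length (golay_sequence e w A B c) = (\<Sum>v<2 ^ e. l v)"
  using assms by (cases "even c")
    (simp_all add: golay_sequence_def length_sylvester_concat scale_by_var_def complex_golay_pair_def)

lemma set_golay_sequence:
  assumes "\<And>v. v < 2 ^ e \<Longrightarrow> complex_golay_pair (l v) (A v) (B v)"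
    and "\<And>v. v < 2 ^ e \<Longrightarrow> w v < t"
  shows "set (golay_sequence e w A B c) \<subseteq> unit_terms t"
  unfolding golay_sequence_def
proof (rule set_sylvester_concat[OF uminus_mem_unit_terms])
  fix v :: nat assume "v < 2 ^ e"
  with assms have "set (if even c then A v else B v) \<subseteq> {1, -1, \<i>, -\<i>}" "w v < t"
    by (simp_all add: complex_golay_pair_def)
  then show "set (scale_by_var (w v) (if even c then A v else B v)) \<subseteq> unit_terms t"
    unfolding scale_by_var_def unit_terms_def by fastforce
qed

lemma sum_double: "(\<Sum>c<2 * P. g c) = (\<Sum>h<P. g (2 * h) + g (2 * h + 1))"
  for g :: "nat \<Rightarrow> 'a :: comm_monoid_add"
  by (induction P) (simp_all add: add.assoc)

lemma single_sum: "Poly_Mapping.single k (\<Sum>x\<in>A. f x) = (\<Sum>x\<in>A. Poly_Mapping.single k (f x))"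
  by (induction A rule: infinite_finite_induct) (simp_all add: single_add)

lemma sum_autocorr_poly_golay_sequence:
  assumes "\<And>v. v < 2 ^ e \<Longrightarrow> complex_golay_pair (l v) (A v) (B v)"
  shows "(\<Sum>c<2 ^ Suc e. cpoly.autocorr_poly (golay_sequence e w A B c)) =
    Poly_Mapping.single 0 (2 ^ Suc e * (\<Sum>v<2 ^ e. of_nat (l v) * (var (w v))\<^sup>2))"
proof -
  have "(\<Sum>c<2 ^ Suc e. cpoly.autocorr_poly (golay_sequence e w A B c)) =
      (\<Sum>h<2 ^ e. cpoly.autocorr_poly (sylvester_concat e (\<lambda>v. scale_by_var (w v) (A v)) h)) +
      (\<Sum>h<2 ^ e. cpoly.autocorr_poly (sylvester_concat e (\<lambda>v. scale_by_var (w v) (B v)) h))"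
    by (simp add: sum_double golay_sequence_def sum.distrib)
  also have "\<dots> = 2 ^ e * (\<Sum>v<2 ^ e. Poly_Mapping.single 0 (of_nat (2 * l v) * (var (w v))\<^sup>2))"
    unfolding cpoly.sum_autocorr_poly_sylvester_concat distrib_left[symmetric] sum.distrib[symmetric]
    using assms by (intro arg_cong2[where f = "(*)"] sum.cong refl autocorr_poly_complex_golay_pair) simp
  also have "\<dots> = Poly_Mapping.single 0 (of_nat (2 ^ e)) *
      Poly_Mapping.single 0 (\<Sum>v<2 ^ e. of_nat (2 * l v) * (var (w v))\<^sup>2)"
    by (simp only: single_of_nat single_sum) simp
  also have "\<dots> = Poly_Mapping.single 0 (2 ^ Suc e * (\<Sum>v<2 ^ e. of_nat (l v) * (var (w v))\<^sup>2))"
    by (simp add: mult_single sum_distrib_left mult_ac)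
  finally show ?thesis .
qed

definition fibre_sum :: "'v set \<Rightarrow> ('v \<Rightarrow> 'j) \<Rightarrow> ('v \<Rightarrow> nat) \<Rightarrow> 'j \<Rightarrow> nat" where
  "fibre_sum V w l j = (\<Sum>v\<in>{v \<in> V. w v = j}. l v)"

lemma sum_fibre_sum_mult:
  fixes g :: "nat \<Rightarrow> 'a :: semiring_1"
  assumes "finite V" "w ` V \<subseteq> {..<t}"
  shows "(\<Sum>j<t. of_nat (fibre_sum V w l j) * g j) = (\<Sum>v\<in>V. of_nat (l v) * g (w v))"
proof -
  have "(\<Sum>j<t. of_nat (fibre_sum V w l j) * g j) =
      (\<Sum>j<t. \<Sum>v\<in>{v \<in> V. w v = j}. of_nat (l v) * g (w v))"
    by (simp add: fibre_sum_def sum_distrib_right)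
  also have "\<dots> = (\<Sum>v\<in>V. of_nat (l v) * g (w v))"
    by (rule sum.group) (use assms in auto)
  finally show ?thesis .
qed

lemma fibre_sum_pos:
  assumes "finite V" "\<And>v. v \<in> V \<Longrightarrow> l v > 0" "j \<in> w ` V"
  shows "fibre_sum V w l j > 0"
  unfolding fibre_sum_def using assms by (intro sum_pos) auto

lemma exists_COD_of_complex_golay_numbers:
  fixes l w :: "nat \<Rightarrow> nat"
  assumes golay: "\<And>v. v < 2 ^ e \<Longrightarrow> complex_golay_number (l v)"
    and w_image: "w ` {..<2 ^ e} = {..<t}"
    and q_eq: "q = 2 ^ Suc e + Suc e"
  shows "\<exists>X. is_COD (2 ^ q * (\<Sum>v<2 ^ e. l v))
    (map (\<lambda>j. 2 ^ q * fibre_sum {..<2 ^ e} w l j) [0..<t]) X"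
proof -
  define cs where "cs = map (\<lambda>j. 2 ^ q * fibre_sum {..<2 ^ e} w l j) [0..<t]"
  obtain A B where golay_pairs: "\<And>v. v < 2 ^ e \<Longrightarrow> complex_golay_pair (l v) (A v) (B v)"
    using golay unfolding complex_golay_number_def by metis
  have l_pos: "l v > 0" if "v < 2 ^ e" for v
    using golay[OF that] by (simp add: complex_golay_number_def)
  have "\<exists>X. is_COD (2 ^ (2 ^ Suc e + Suc e) * (\<Sum>v<2 ^ e. l v)) cs X"
  proof (rule exists_COD_of_complementary_sequences
        [OF _ _ _ sum_autocorr_poly_golay_sequence[OF golay_pairs]])
    show "(\<Sum>v<2 ^ e. l v) > 0"
      using l_pos by (intro sum_pos) (auto simp: lessThan_empty_iff)
    show "length (golay_sequence e w A B c) = (\<Sum>v<2 ^ e. l v)" for c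
      by (rule length_golay_sequence[OF golay_pairs])
    show "set (golay_sequence e w A B c) \<subseteq> unit_terms (length cs)" for c
      by (rule set_golay_sequence[OF golay_pairs]) (use w_image in \<open>auto simp: cs_def\<close>)
    show "(\<Sum>j<length cs. of_nat (cs ! j) * (var j)\<^sup>2) =
        2 ^ 2 ^ Suc e * (2 ^ Suc e * (\<Sum>v<2 ^ e. of_nat (l v) * (var (w v))\<^sup>2))"
    proof -
      have "(\<Sum>j<length cs. of_nat (cs ! j) * (var j)\<^sup>2) =
          2 ^ q * (\<Sum>j<t. of_nat (fibre_sum {..<2 ^ e} w l j) * (var j)\<^sup>2)"
        by (simp add: cs_def sum_distrib_left mult.assoc)
      also have "\<dots> = 2 ^ q * (\<Sum>v<2 ^ e. of_nat (l v) * (var (w v))\<^sup>2)"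
        using w_image by (simp add: sum_fibre_sum_mult)
      finally show ?thesis
        by (simp add: q_eq power_add mult.assoc)
    qed
    show "c > 0" if "c \<in> set cs" for c
      using that w_image l_pos by (auto simp: cs_def intro!: fibre_sum_pos)
  qed
  then show ?thesis
    by (simp only: cs_def q_eq)
qed

lemma complex_golay_number_if_golay_number: "golay_number r \<Longrightarrow> complex_golay_number r"
  unfolding golay_number_def complex_golay_number_def golay_pair_def complex_golay_pair_def by blast

lemma complex_golay_number_1: "complex_golay_number 1"
  unfolding complex_golay_number_def complex_golay_pair_def complementary_def autocorr_def
  by (auto intro!: exI[of _ "[1]"])

definition block_length :: "nat \<Rightarrow> (nat \<Rightarrow> nat) \<Rightarrow> nat \<Rightarrow> nat" where
  "block_length r k v = (if v = 0 then 1 else if v = 1 then r else k (v div 2))"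

definition block_var :: "nat \<Rightarrow> nat" where
  "block_var v = (if v < 2 then v else v div 2 + 1)"

lemma block_var_fibre:
  assumes "j \<le> P" "P > 0"
  shows "{v \<in> {..<2 * P}. block_var v = j} = (if j < 2 then {j} else {2 * j - 2, 2 * j - 1})"
  using assms by (auto simp: block_var_def)

lemma block_var_image:
  assumes "P > 0"
  shows "block_var ` {..<2 * P} = {..<Suc P}"
proof -
  have "j \<in> block_var ` {..<2 * P}" if "j < Suc P" for j
  proof -
    have "{v \<in> {..<2 * P}. block_var v = j} \<noteq> {}"
      using that assms by (subst block_var_fibre) auto
    then show ?thesis by auto
  qed
  then show ?thesis
    by (auto simp: block_var_def)
qed

lemma fibre_sum_block_length:
  assumes "j \<le> P" "P > 0"
  shows "fibre_sum {..<2 * P} block_var (block_length r k) j =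
    (if j = 0 then 1 else if j = 1 then r else 2 * k (j - 1))"
proof (cases "j < 2")
  case False
  then obtain i where "j = i + 2"
    by (metis add.commute le_add_diff_inverse not_less)
  then show ?thesis
    unfolding fibre_sum_def block_var_fibre[OF assms] by (simp add: block_length_def)
next
  case True
  then show ?thesis
    unfolding fibre_sum_def block_var_fibre[OF assms] by (auto simp: block_length_def)
qed

lemma map_fibre_sum_block_length:
  assumes "P > 0"
  shows "map (\<lambda>j. N * fibre_sum {..<2 * P} block_var (block_length r k) j) [0..<Suc P] =
    [N, N * r] @ map (\<lambda>j. 2 * N * k j) [1..<P]"
proof -
  have "[0..<Suc P] = [0, 1] @ map Suc [1..<P]"
    using assms by (simp add: map_Suc_upt upt_conv_Cons del: upt_Suc)
  then show ?thesis
    using assms by (simp add: fibre_sum_block_length del: upt_Suc)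
qed

lemma sum_block_length:
  assumes "P > 0"
  shows "(\<Sum>v<2 * P. block_length r k v) = 2 * (\<Sum>j = 1..P - 1. k j) + r + 1"
proof -
  have "{..<P} = insert 0 {1..P - 1}"
    using assms by auto
  then show ?thesis
    unfolding sum_double by (simp add: block_length_def sum_distrib_left mult_2)
qed

theorem theorem17:
  fixes n r m q :: nat and k :: "nat \<Rightarrow> nat"
  assumes "n > 2"
    and "golay_number r"
    and "\<And>j. j \<in> {1..2 ^ (n - 3) - 1} \<Longrightarrow> complex_golay_number (k j)"
    and "m = 2 * (\<Sum>j = 1..2 ^ (n - 3) - 1. k j) + r + 1"
    and "q = 2 ^ (n - 1) + n - 1"
  shows "\<exists>X. is_COD (2 ^ q * m)
    ([2 ^ q, 2 ^ q * r] @ map (\<lambda>j. 2 ^ (q + 1) * k j) [1..<2 ^ (n - 3)]) X"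
proof -
  obtain d where n_eq: "n = d + 3"
    using \<open>n > 2\<close> by (metis Suc_leI add.commute le_Suc_ex eval_nat_numeral(3))
  define P :: nat where "P = 2 ^ d"
  have P_pos: "P > 0" and power_d: "2 ^ Suc d = 2 * P" and q_eq: "q = 2 ^ Suc (Suc d) + Suc (Suc d)"
    by (simp_all add: P_def n_eq assms(5))
  have golay: "complex_golay_number (block_length r k v)" if "v < 2 * P" for v
  proof -
    have "v div 2 \<in> {1..2 ^ (n - 3) - 1}" if "v \<ge> 2"
      using that \<open>v < 2 * P\<close> by (auto simp: P_def n_eq)
    then consider "v = 0" | "v = 1" | "v div 2 \<in> {1..2 ^ (n - 3) - 1}"
      by linarith
    then show ?thesis
      using complex_golay_number_1 complex_golay_number_if_golay_number[OF assms(2)] assms(3)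
      by cases (auto simp: block_length_def)
  qed
  have "\<exists>X. is_COD (2 ^ q * (\<Sum>v<2 * P. block_length r k v))
      (map (\<lambda>j. 2 ^ q * fibre_sum {..<2 * P} block_var (block_length r k) j) [0..<Suc P]) X"
    using exists_COD_of_complex_golay_numbers
      [of "Suc d", unfolded power_d, OF golay block_var_image[OF P_pos] q_eq] .
  then show ?thesis
    unfolding sum_block_length[OF P_pos] map_fibre_sum_block_length[OF P_pos]
    by (simp add: assms(4) P_def n_eq)
qed

end
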